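(* Let $A\in\mathbb{R}^{n\times n}$, $C\in\mathbb{R}^{p\times n}$, $N\ge1$, let $O\in\mathbb{R}^{Np\times n}$ be the observability matrix and $W_o=O^\top O$ the observability Gramian. Let $\mathrm{rank}(O)=n$, so that $W_o\succ0$. Let $\mathcal{M}=\{1,\dots,Np\}$ index the rows of $O$, let $L_{\mathcal{M}}\in\mathbb{R}^{Np\times Np}$ be given by $(L_{\mathcal{M}})_{ij}=\tilde o_i^\top\tilde o_j$, where $\tilde o_i^\top$ is the $i$-th row of $O$, and let $\lambda_1,\dots,\lambda_{Np}$ be the eigenvalues of $L_{\mathcal{M}}$. Let $Y'\sim\mathcal{P}^n_{L_{\mathcal{M}}}$ be drawn from the $k$-DPP of $L_{\mathcal{M}}$ with cardinality $k=n$. Then: (i) the nonzero eigenvalues of $L_{\mathcal{M}}$ are the eigenvalues of $W_o$, and $e_n(\lambda_1,\dots,\lambda_{Np})=\det(W_o)$; (ii) every $S\subseteq\mathcal{M}$ with $|S|=n$ satisfies $$\mathcal{P}^n_{L_{\mathcal{M}}}(S)=\frac{\det((L_{\mathcal{M}})_S)}{\det(W_o)}=\frac{\det(O_S)^2}{\det(W_o)};$$ (iii) the marginal kernel of $\mathcal{P}^n_{L_{\mathcal{M}}}$ is the orthogonal projection $$K_o=O\,W_o^{-1}O^\top\in\mathbb{R}^{Np\times Np},$$ where every $A'\subseteq\mathcal{M}$ satisfies $\mathbb{P}(A'\subseteq Y')=\det((K_o)_{A'})$, and the marginal inclusion probability of measurement $i$ is $(K_o)_{ii}=\tilde o_i^\top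 W_o^{-1}\tilde o_i$; (iv) every sensor configuration $Y\subseteq\mathcal{Y}=\{1,\dots,p\}$ satisfies $$\mathbb{P}(Y'\subseteq\mathcal{M}_Y)=\frac{\det(W_o(Y))}{\det(W_o)}.$$
   Context: For $x[k+1]=Ax[k]+Bu[k]$, $y[k]=Cx[k]$ with $C\in\mathbb{R}^{p\times n}$, the observability matrix over horizon $N$ is $O=[C^\top,(CA)^\top,\dots,(CA^{N-1})^\top]^\top\in\mathbb{R}^{Np\times n}$ and the observability Gramian is $W_o=\sum_{k=0}^{N-1}(A^k)^\top C^\top CA^k=O^\top O$. For a set of sensors $Y\subseteq\{1,\dots,p\}$, $C_Y$ consists of the rows of $C$ indexed by $Y$, and $W_o(Y)=\sum_{k=0}^{N-1}(A^k)^\top C_Y^\top C_YA^k$. The set $\mathcal{M}_Y\subseteq\mathcal{M}$ consists of the indices of the rows of $O$ generated by the sensors in $Y$, i.e. the rows $c_i^\top A^k$ with $i\in Y$, $0\le k\le N-1$, where $c_i^\top$ is the $i$-th row of $C$. For $S\subseteq\mathcal{M}$, $O_S$ is the submatrix of $O$ with rows indexed by $S$. For a matrix $M$ and an index set $S$, $M_S=[M_{ij}]_{i,j\in S}$ denotes the principal submatrix when $M$ is one of the square matrices $L_{\mathcal{M}}$, $K_o$; $\det(M_\emptyset)=1$. For a symmetric $L\succeq0$ with eigenvalues $\lambda_1,\dots,\lambda_q$, the $k$-DPP of cardinality $r$ is the probability measure on subsets $S$ of the index set with $|S|=r$ given by $\mathcal{P}^r_L(S)=\det(L_S)/e_r(\lambda_1,\dots,\lambda_q)$,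 where $e_r$ is the $r$-th elementary symmetric polynomial, $e_r(\lambda_1,\dots,\lambda_q)=\sum_{|S'|=r}\det(L_{S'})$. A marginal kernel of a random subset $Y'$ is a matrix $K$ with $\mathbb{P}(A'\subseteq Y')=\det(K_{A'})$ for all $A'$. *)

theory Defs
  imports
    "HOL-Probability.Probability_Mass_Function"
    "Jordan_Normal_Form.Char_Poly"
    "Jordan_Normal_Form.DL_Rank"
    "Jordan_Normal_Form.DL_Submatrix"
    "Jordan_Normal_Form.Gauss_Jordan_Elimination"
begin

text \<open>
  All indices are 0-based: states are \<open>0, \<dots>, n - 1\<close>, sensors are \<open>0, \<dots>, p - 1\<close>, and the
  measurements (rows of the observability matrix) are \<open>0, \<dots>, N * p - 1\<close>, where measurement
  \<open>k * p + i\<close> is the reading of sensor \<open>i\<close> at time \<open>k\<close>.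
\<close>

text \<open>Row \<open>k * p + i\<close> is row \<open>i\<close> of \<open>C A\<^sup>k\<close>: the blocks \<open>C, C A, \<dots>, C A\<^sup>N\<^sup>-\<^sup>1\<close> are stacked vertically.\<close>

definition obs_matrix :: "real mat \<Rightarrow> real mat \<Rightarrow> nat \<Rightarrow> real mat" where
  "obs_matrix A C N =
     mat (N * dim_row C) (dim_row A)
       (\<lambda>(r, j). (C * A ^\<^sub>m (r div dim_row C)) $$ (r mod dim_row C, j))"

lemma row_obs_matrix:
  assumes "A \<in> carrier_mat n n" "C \<in> carrier_mat p n" "k < N" "i < p"
  shows "row (obs_matrix A C N) (k * p + i) = row (C * A ^\<^sub>m k) i"
proof -
  have "Suc k * p \<le> N * p" using assms(3) by (intro mult_le_mono1) simp
  then have bound: "k * p + i < N * p" using assms(4) by simp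
  have carrier: "C * A ^\<^sub>m k \<in> carrier_mat p n"
    using assms(1,2) by (intro mult_carrier_mat pow_carrier_mat) auto
  have dims: "dim_row C = p" "dim_row A = n" "dim_row (C * A ^\<^sub>m k) = p" "dim_col (C * A ^\<^sub>m k) = n"
    using assms carrier by auto
  show ?thesis
    unfolding obs_matrix_def Matrix.row_def
    using bound assms(4) dims by (intro eq_vecI) (auto simp del: index_mult_mat)
qed

text \<open>Matrices do not form an additive monoid type, so the sum over time is taken entrywise.\<close>

definition obs_gramian :: "real mat \<Rightarrow> real mat \<Rightarrow> nat \<Rightarrow> real mat" where
  "obs_gramian A C N =
     mat (dim_row A) (dim_row A)
       (\<lambda>(i, j). \<Sum>k<N. (transpose_mat (A ^\<^sub>m k) * transpose_mat C * C * A ^\<^sub>m k) $$ (i, j))"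

definition row_submatrix :: "'a mat \<Rightarrow> nat set \<Rightarrow> 'a mat" where
  "row_submatrix M S = submatrix M S UNIV"

definition principal_submatrix :: "'a mat \<Rightarrow> nat set \<Rightarrow> 'a mat" where
  "principal_submatrix M S = submatrix M S S"

definition obs_gramian_sensors :: "real mat \<Rightarrow> real mat \<Rightarrow> nat \<Rightarrow> nat set \<Rightarrow> real mat" where
  "obs_gramian_sensors A C N Y = obs_gramian A (row_submatrix C Y) N"

definition sensor_measurements :: "nat \<Rightarrow> nat \<Rightarrow> nat set \<Rightarrow> nat set" where
  "sensor_measurements p N Y = {k * p + i | k i. k < N \<and> i \<in> Y}"

definition row_gram :: "real mat \<Rightarrow> real mat" where
  "row_gram M = mat (dim_row M) (dim_row M) (\<lambda>(i, j). row M i \<bullet> row M j)"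

definition pos_def_mat :: "real mat \<Rightarrow> bool" where
  "pos_def_mat M \<longleftrightarrow> M \<in> carrier_mat (dim_row M) (dim_row M) \<and> transpose_mat M = M \<and>
     (\<forall>v \<in> carrier_vec (dim_row M). v \<noteq> 0\<^sub>v (dim_row M) \<longrightarrow> 0 < v \<bullet> (M *\<^sub>v v))"

definition orthogonal_projection_mat :: "real mat \<Rightarrow> bool" where
  "orthogonal_projection_mat M \<longleftrightarrow> M \<in> carrier_mat (dim_row M) (dim_row M) \<and>
     M * M = M \<and> transpose_mat M = M"

text \<open>
  The real eigenvalues in increasing order, repeated according to algebraic multiplicity. For a
  real symmetric matrix these are all the eigenvalues.
\<close>

definition eigvals :: "real mat \<Rightarrow> real list" where
  "eigvals M = sorted_list_of_multiset (proots (char_poly M))"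

definition elem_sym :: "nat \<Rightarrow> real list \<Rightarrow> real" where
  "elem_sym r xs = (\<Sum>S | S \<subseteq> {..<length xs} \<and> card S = r. \<Prod>i\<in>S. xs ! i)"

text \<open>
  The \<open>k\<close>-DPP of cardinality \<open>r\<close>. Outside its intended domain, \<open>L\<close> symmetric positive
  semidefinite with nonzero normalising constant, the value is arbitrary.
\<close>

definition kdpp :: "real mat \<Rightarrow> nat \<Rightarrow> nat set pmf" where
  "kdpp L r = embed_pmf (\<lambda>S.
     if S \<subseteq> {..<dim_row L} \<and> card S = r
     then det (principal_submatrix L S) / elem_sym r (eigvals L) else 0)"

definition marginal_kernel :: "nat \<Rightarrow> nat set pmf \<Rightarrow> real mat \<Rightarrow> bool" where
  "marginal_kernel q P K \<longleftrightarrow> K \<in> carrier_mat q q \<and>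
     (\<forall>A' \<subseteq> {..<q}. measure_pmf.prob P {Y'. A' \<subseteq> Y'} = det (principal_submatrix K A'))"

end

(* The weight of S is det(O_S)^2 / det W_o, and the Cauchy-Binet formula with a diagonal weight Z,
     det(O^T Z O) = sum over |S| = n of (prod over i in S of z_i) det(O_S)^2,
   is the generating function of this distribution. For Z = I it gives the normalising constant and
   for Z the indicator of the measurements of Y it gives the probability of Y' being contained in
   them. For the superset probabilities take z_i = 1/s on A' and 1 elsewhere: Sylvester's identity
   det(I - XY) = det(I - YX) turns det(O^T Z O) into det W_o * det(s I + (1 - s) K_{A'}) / s^|A'|, and
   letting s tend to 0 leaves det K_{A'}. The same identity over polynomials relates the spectra of
   O O^T and O^T O. *)

theory Submission
  imports Defs
begin

text \<open>Superset probabilities are the hard part: a diagonal weight can switch measurements off,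
  but it cannot force one in. Weights 1/s on A' merely favour the sets that contain A'. Multiplying
  by s^|A'| turns the factor of S into s^|A' - S|, which at s = 0 is the indicator of A' \<subseteq>
  S. The weights have a pole there, hence the limit; after the rescaling both sides are polynomial
  in s. The spectral claims meet another obstacle: \<open>eigvals\<close> collects real roots only,
  so its length and product are known only once the characteristic polynomial of a real symmetric
  matrix has been split over the reals, which is done through the complex numbers. Then e_n
  collapses to a single product, because exactly n eigenvalues of O O^T are nonzero. In the k-DPP
  part O is an arbitrary real matrix with invertible Gram matrix; the linear system enters only when
  its Gramians are recognised as weighted Gram matrices of \<open>obs_matrix\<close>.\<close>

subsection \<open>The Cauchy--Binet formula\<close>

text \<open>The inverse counts the elements of \<open>S\<close> below a given one. Submatrices are
  indexed by position, whereas sums and products run over the elements of \<open>S\<close>; this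
  bijection translates between the two.\<close>

lemma bij_betw_pick:
  assumes "finite S"
  shows "bij_betw (pick S) {0..<card S} S"
proof (rule bij_betw_byWitness[where f' = "\<lambda>i. card {a \<in> S. a < i}"])
  show "\<forall>a\<in>{0..<card S}. card {b \<in> S. b < pick S a} = a"
    by (auto intro: card_pick)
  show "\<forall>a'\<in>S. pick S (card {a \<in> S. a < a'}) = a'"
    by (auto intro: pick_card_in_set)
  show "pick S ` {0..<card S} \<subseteq> S"
    by (auto intro: pick_in_set)
  show "(\<lambda>i. card {a \<in> S. a < i}) ` S \<subseteq> {0..<card S}"
    using assms by (auto intro!: psubset_card_mono)
qed

text \<open>Multilinearity in the rows expands the determinant into a sum over all maps
  \<open>f\<close> from row indices to \<open>{0..<m}\<close>. Non-injective maps give a repeated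
  row. An injective map is the same as its image \<open>S\<close> together with a permutation, and
  summing over the permutations is the Leibniz formula for the minor of \<open>A\<close>.\<close>

lemma cauchy_binet:
  fixes A B :: "'a :: comm_ring_1 mat"
  assumes A: "A \<in> carrier_mat n m" and B: "B \<in> carrier_mat m n"
  shows "det (A * B) = (\<Sum>S | S \<subseteq> {..<m} \<and> card S = n.
    det (submatrix A UNIV S) * det (submatrix B S UNIV))"
proof -
  let ?U = "{0..<n}"
  \<comment> \<open>Fixing \<open>f i = i\<close> outside \<open>?U\<close> keeps the set of maps
    finite and agrees with the convention of \<open>permutes\<close>.\<close>
  define F where "F = {f. (\<forall>i\<in>?U. f i \<in> {0..<m}) \<and> (\<forall>i. i \<notin> ?U \<longrightarrow> f i = i)}"
  define D where "D f = det (mat\<^sub>r n n (\<lambda>i. row B (f i)))" for f :: "nat \<Rightarrow> nat"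
  define g where "g f = (\<Prod>i\<in>?U. A $$ (i, f i)) * D f" for f :: "nat \<Rightarrow> nat"
  define Sub where "Sub = {S. S \<subseteq> {..<m} \<and> card S = n}"
  \<comment> \<open>\<open>perm_fun\<close> sends \<open>i\<close> to the element of
    \<open>S\<close> at position \<open>\<sigma> i\<close>; \<open>fun_perm\<close> undoes this by
    recording the image of \<open>f\<close> and the rank of each value \<open>f i\<close> within
    it.\<close>
  define perm_fun where "perm_fun = (\<lambda>(S, \<sigma>) i. if i \<in> ?U then pick S (\<sigma> i) else i)"
  define rnk where "rnk S x = card {a \<in> S. a < x}" for S :: "nat set" and x
  define fun_perm where "fun_perm f = (f ` ?U, \<lambda>i. if i \<in> ?U then rnk (f ` ?U) (f i) else i)"
    for f :: "nat \<Rightarrow> nat"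
  have pick_rnk: "pick S (rnk S x) = x" if "x \<in> S" for S x
    using pick_card_in_set[OF that] unfolding rnk_def .
  have rnk_lt: "rnk S x < card S" if "finite S" "x \<in> S" for S x
    unfolding rnk_def using that by (intro psubset_card_mono) auto
  have finF: "finite F" unfolding F_def by (rule finite_bounded_functions) auto
  have fin_S: "finite S" if "S \<in> Sub" for S using that finite_subset unfolding Sub_def by auto
  have bij: "bij_betw (pick S) ?U S" if "S \<in> Sub" for S
    using bij_betw_pick[OF fin_S[OF that]] that unfolding Sub_def by simp
  have D0: "D f = 0" if f: "f \<in> F" and ninj: "\<not> inj_on f ?U" for f
  proof -
    obtain i j where ij: "f i = f j" "i \<noteq> j" "i < n" "j < n"
      using ninj unfolding inj_on_def by auto
    have "row (mat\<^sub>r n n (\<lambda>i. row B (f i))) i = row (mat\<^sub>r n n (\<lambda>i. row B (f i))) j"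
      using ij by auto
    then show ?thesis unfolding D_def by (intro det_identical_rows[OF _ ij(2-4)]) auto
  qed
  have Dperm: "D (perm_fun (S, \<sigma>)) = signof \<sigma> * det (submatrix B S UNIV)"
    if S: "S \<in> Sub" and \<sigma>: "\<sigma> permutes ?U" for S \<sigma>
  proof -
    have cS: "card {i. i < m \<and> i \<in> S} = n"
      using S unfolding Sub_def by (auto intro!: arg_cong[where f = card])
    have car: "submatrix B S UNIV \<in> carrier_mat n n"
      using B cS by (auto simp: dim_submatrix)
    have lt: "\<sigma> i < n" if "i < n" for i using permutes_in_image[OF \<sigma>, of i] that by simp
    \<comment> \<open>The selected rows of \<open>B\<close> are those of the submatrix on
      \<open>S\<close>, reordered by \<open>\<sigma>\<close>; this produces the sign.\<close>
    have "mat\<^sub>r n n (\<lambda>i. row B (perm_fun (S, \<sigma>) i))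
      = mat n n (\<lambda>(i, j). submatrix B S UNIV $$ (\<sigma> i, j))"
    proof (rule eq_matI, goal_cases)
      case (1 i j)
      then have ij: "i < n" "j < n" by auto
      then have "pick S (\<sigma> i) < m" using bij[OF S] lt[OF ij(1)] S
        unfolding bij_betw_def Sub_def by auto
      moreover have "submatrix B S UNIV $$ (\<sigma> i, j) = B $$ (pick S (\<sigma> i), j)"
        using ij lt[OF ij(1)] cS B by (subst submatrix_index) (auto simp: pick_UNIV)
      ultimately show ?case using ij B by (simp add: perm_fun_def)
    qed auto
    then show ?thesis unfolding D_def using det_permute_rows[OF car \<sigma>] by simp
  qed
  have "det (A * B) = (\<Sum>f\<in>F. det (mat\<^sub>r n n (\<lambda>i. A $$ (i, f i) \<cdot>\<^sub>v row B (f i))))"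
    unfolding mat_mul_finsum_alt[OF A B] F_def
    by (rule det_linear_rows_sum) (use A B in auto)
  also have "\<dots> = (\<Sum>f\<in>F. g f)"
    unfolding g_def D_def by (intro sum.cong refl det_rows_mul) (use B in auto)
  also have "\<dots> = (\<Sum>f\<in>{f\<in>F. inj_on f ?U}. g f)"
    by (rule sum.mono_neutral_right) (use finF D0 in \<open>auto simp: g_def\<close>)
  also have "\<dots> = (\<Sum>(S, \<sigma>)\<in>Sub \<times> {\<sigma>. \<sigma> permutes ?U}. g (perm_fun (S, \<sigma>)))"
  proof (rule sum.reindex_bij_witness[where i = perm_fun and j = fun_perm], goal_cases)
    case (1 f)
    then show ?case by (auto simp: perm_fun_def fun_perm_def F_def pick_rnk)
  next
    case (2 f)
    let ?\<sigma> = "snd (fun_perm f)"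
    have inj: "inj_on f ?U" and FI: "f ` ?U \<subseteq> {..<m}" using 2 unfolding F_def by auto
    have cardI: "card (f ` ?U) = n" using inj by (simp add: card_image)
    have lt: "rnk (f ` ?U) (f i) < n" if "i < n" for i
      using rnk_lt[of "f ` ?U" "f i"] cardI that by simp
    have "inj_on ?\<sigma> ?U"
    proof (rule inj_onI)
      fix i j assume ij: "i \<in> ?U" "j \<in> ?U" and eq: "?\<sigma> i = ?\<sigma> j"
      then have "rnk (f ` ?U) (f i) = rnk (f ` ?U) (f j)"
        by (simp add: fun_perm_def)
      then have "f i = f j" using ij pick_rnk by (metis imageI)
      then show "i = j" using inj ij by (auto dest: inj_onD)
    qed
    then have "?\<sigma> permutes ?U"
      by (rule inj_on_nat_permutes) (use lt in \<open>auto simp: fun_perm_def\<close>)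
    then show ?case using FI cardI by (simp add: fun_perm_def Sub_def)
  next
    case (3 S\<sigma>)
    obtain S \<sigma> where S\<sigma>: "S\<sigma> = (S, \<sigma>)" and S: "S \<in> Sub" and \<sigma>: "\<sigma> permutes ?U"
      using 3 by auto
    have img: "perm_fun (S, \<sigma>) ` ?U = S"
    proof -
      have "perm_fun (S, \<sigma>) ` ?U = pick S ` \<sigma> ` ?U"
        unfolding image_image perm_fun_def by (rule image_cong) auto
      then show ?thesis using permutes_image[OF \<sigma>] bij[OF S] by (simp add: bij_betw_def)
    qed
    have "rnk S (pick S (\<sigma> i)) = \<sigma> i" if "i < n" for i
      unfolding rnk_def using S permutes_in_image[OF \<sigma>, of i] that
      by (intro card_pick) (simp_all add: Sub_def)
    then have "snd (fun_perm (perm_fun (S, \<sigma>))) = \<sigma>"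
      using permutes_not_in[OF \<sigma>] unfolding fun_perm_def img by (auto simp: perm_fun_def)
    then show ?case using img unfolding S\<sigma> by (simp add: fun_perm_def)
  next
    case (4 S\<sigma>)
    obtain S \<sigma> where S\<sigma>: "S\<sigma> = (S, \<sigma>)" and S: "S \<in> Sub" and \<sigma>: "\<sigma> permutes ?U"
      using 4 by auto
    have "bij_betw (pick S \<circ> \<sigma>) ?U S"
      using bij_betw_trans[OF permutes_imp_bij[OF \<sigma>] bij[OF S]] .
    then have "bij_betw (perm_fun (S, \<sigma>)) ?U S"
      by (rule bij_betw_cong[THEN iffD1, rotated]) (auto simp: perm_fun_def)
    then show ?case using S unfolding S\<sigma> F_def Sub_def bij_betw_def
      by (auto simp: perm_fun_def)
  next
    case (5 f)
    then have "perm_fun (fun_perm f) = f"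
      by (auto simp: perm_fun_def fun_perm_def F_def pick_rnk)
    then show ?case by (simp add: case_prod_unfold)
  qed
  also have "\<dots> = (\<Sum>S\<in>Sub. \<Sum>\<sigma> | \<sigma> permutes ?U. g (perm_fun (S, \<sigma>)))"
    by (simp add: sum.cartesian_product)
  also have "\<dots> = (\<Sum>S\<in>Sub. det (submatrix A UNIV S) * det (submatrix B S UNIV))"
  proof (rule sum.cong[OF refl])
    fix S assume S: "S \<in> Sub"
    have cS: "card {i. i < m \<and> i \<in> S} = n"
      using S unfolding Sub_def by (auto intro!: arg_cong[where f = card])
    have car: "submatrix A UNIV S \<in> carrier_mat n n"
      using A cS by (auto simp: dim_submatrix)
    have "g (perm_fun (S, \<sigma>)) =
        signof \<sigma> * (\<Prod>i = 0..<n. submatrix A UNIV S $$ (i, \<sigma> i)) * det (submatrix B S UNIV)"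
      if \<sigma>: "\<sigma> permutes ?U" for \<sigma>
    proof -
      have "(\<Prod>i\<in>?U. A $$ (i, perm_fun (S, \<sigma>) i)) = (\<Prod>i\<in>?U. submatrix A UNIV S $$ (i, \<sigma> i))"
      proof (rule prod.cong[OF refl])
        fix i assume i: "i \<in> ?U"
        then have "\<sigma> i < n" using permutes_in_image[OF \<sigma>, of i] by simp
        then show "A $$ (i, perm_fun (S, \<sigma>) i) = submatrix A UNIV S $$ (i, \<sigma> i)"
          using i A cS by (subst submatrix_index) (auto simp: pick_UNIV perm_fun_def)
      qed
      then show ?thesis unfolding g_def Dperm[OF S \<sigma>] by (simp add: ac_simps)
    qed
    then show "(\<Sum>\<sigma> | \<sigma> permutes ?U. g (perm_fun (S, \<sigma>)))
      = det (submatrix A UNIV S) * det (submatrix B S UNIV)"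
      unfolding det_def'[OF car] sum_distrib_right by (intro sum.cong) auto
  qed
  finally show ?thesis unfolding Sub_def .
qed

subsection \<open>Characteristic polynomials and real spectra\<close>

text \<open>The block matrix \<open>M\<close> with rows (x I, X) and (Y, I) is triangularised in two
  ways: \<open>M * T\<close> gives the left determinant and \<open>T' * M\<close> the right one, the
  latter at the price of the factor \<open>x ^ m\<close>. Nothing is divided by \<open>x\<close>, so
  \<open>x\<close> may be a polynomial indeterminate as well as a number.\<close>

lemma det_smult_one_minus_mult_swap:
  fixes X Y :: "'a :: idom mat"
  assumes X: "X \<in> carrier_mat n m" and Y: "Y \<in> carrier_mat m n"
  shows "x ^ m * det (x \<cdot>\<^sub>m 1\<^sub>m n - X * Y) = x ^ n * det (x \<cdot>\<^sub>m 1\<^sub>m m - Y * X)"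
proof -
  define M where "M = four_block_mat (x \<cdot>\<^sub>m 1\<^sub>m n) X Y (1\<^sub>m m)"
  define T where "T = four_block_mat (1\<^sub>m n) (0\<^sub>m n m) (- Y) (1\<^sub>m m)"
  define T' where "T' = four_block_mat (1\<^sub>m n) (0\<^sub>m n m) (- Y) (x \<cdot>\<^sub>m 1\<^sub>m m)"
  have M: "M \<in> carrier_mat (n + m) (n + m)" and T: "T \<in> carrier_mat (n + m) (n + m)"
    and T': "T' \<in> carrier_mat (n + m) (n + m)"
    unfolding M_def T_def T'_def by (intro four_block_carrier_mat; simp)+
  have dT: "det T = 1" unfolding T_def
    by (subst det_four_block_mat_upper_right_zero) (use Y in auto)
  have dT': "det T' = x ^ m" unfolding T'_def
    by (subst det_four_block_mat_upper_right_zero) (use Y in auto)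
  have "M * T = four_block_mat (x \<cdot>\<^sub>m 1\<^sub>m n - X * Y) X (0\<^sub>m m n) (1\<^sub>m m)"
    unfolding M_def T_def
  proof (subst mult_four_block_mat[of _ n n _ m _ m], goal_cases)
    \<comment> \<open>Goals 1 to 8 are the dimensions of the blocks; goal 9 is the equation
      itself.\<close>
    case 9
    show ?case
    proof (rule cong_four_block_mat)
      have "X * - Y = - (X * Y)" using X Y by simp
      then show "x \<cdot>\<^sub>m 1\<^sub>m n * 1\<^sub>m n + X * - Y = x \<cdot>\<^sub>m 1\<^sub>m n - X * Y"
        using X Y by (intro eq_matI) auto
    qed (use X Y in \<open>auto simp: minus_r_inv_mat\<close>)
  qed (use X Y in auto)
  moreover have "det (four_block_mat (x \<cdot>\<^sub>m 1\<^sub>m n - X * Y) X (0\<^sub>m m n) (1\<^sub>m m))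
      = det (x \<cdot>\<^sub>m 1\<^sub>m n - X * Y)"
    by (subst det_four_block_mat_lower_left_zero[OF _ X]) (use X Y in auto)
  ultimately have 1: "det M = det (x \<cdot>\<^sub>m 1\<^sub>m n - X * Y)"
    using det_mult[OF M T] dT by simp
  have "T' * M = four_block_mat (x \<cdot>\<^sub>m 1\<^sub>m n) X (0\<^sub>m m n) (x \<cdot>\<^sub>m 1\<^sub>m m - Y * X)"
    unfolding M_def T'_def
  proof (subst mult_four_block_mat[of _ n n _ m _ m], goal_cases)
    case 9
    show ?case
    proof (rule cong_four_block_mat)
      have "- Y * X = - (Y * X)" using X Y by simp
      then show "- Y * X + x \<cdot>\<^sub>m 1\<^sub>m m * 1\<^sub>m m = x \<cdot>\<^sub>m 1\<^sub>m m - Y * X"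
        using X Y by (intro eq_matI) auto
      have "- Y * (x \<cdot>\<^sub>m 1\<^sub>m n) = - (x \<cdot>\<^sub>m Y)" "x \<cdot>\<^sub>m 1\<^sub>m m * Y = x \<cdot>\<^sub>m Y"
        using Y by (simp_all add: mult_smult_distrib[OF Y one_carrier_mat] mult_smult_assoc_mat[of _ m m])
      then show "- Y * (x \<cdot>\<^sub>m 1\<^sub>m n) + x \<cdot>\<^sub>m 1\<^sub>m m * Y = 0\<^sub>m m n"
        using Y by (simp add: uminus_l_inv_mat)
    qed (use X Y in auto)
  qed (use X Y in auto)
  moreover have "det (four_block_mat (x \<cdot>\<^sub>m 1\<^sub>m n) X (0\<^sub>m m n) (x \<cdot>\<^sub>m 1\<^sub>m m - Y * X))
      = x ^ n * det (x \<cdot>\<^sub>m 1\<^sub>m m - Y * X)"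
    by (subst det_four_block_mat_lower_left_zero[OF _ X]) (use X Y in auto)
  ultimately have "x ^ m * det M = x ^ n * det (x \<cdot>\<^sub>m 1\<^sub>m m - Y * X)"
    using det_mult[OF T' M] dT' by simp
  then show ?thesis unfolding 1 .
qed

text \<open>The preceding identity over the polynomial ring, with \<open>x\<close> the indeterminate
  and the entries of \<open>X\<close> and \<open>Y\<close> embedded as constants.\<close>

lemma char_poly_mult_swap:
  fixes X Y :: "'a :: idom mat"
  assumes X: "X \<in> carrier_mat n m" and Y: "Y \<in> carrier_mat m n"
  shows "[:0, 1:] ^ m * char_poly (X * Y) = [:0, 1:] ^ n * char_poly (Y * X)"
proof -
  let ?h = "map_mat (\<lambda>a :: 'a. [:a:])"
  have *: "char_poly (X * Y) = det ([:0, 1:] \<cdot>\<^sub>m 1\<^sub>m n - ?h X * ?h Y)"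
    if "X \<in> carrier_mat n m" "Y \<in> carrier_mat m n" for X Y :: "'a mat" and n m
  proof -
    have "?h X * ?h Y = ?h (X * Y)" by (rule map_poly_mult(1)[symmetric]) (use that in auto)
    moreover have "char_poly_matrix (X * Y) = [:0, 1:] \<cdot>\<^sub>m 1\<^sub>m n - ?h (X * Y)"
      using that unfolding char_poly_matrix_def by (intro eq_matI) auto
    ultimately show ?thesis unfolding char_poly_def by simp
  qed
  show ?thesis unfolding *[OF X Y] *[OF Y X]
    by (rule det_smult_one_minus_mult_swap) (use X Y in auto)
qed

text \<open>For an eigenvector \<open>v\<close>, the Hermitian form \<open>q\<close> of
  \<open>M\<close> at \<open>v\<close> equals \<open>a\<close> times the squared norm
  \<open>s > 0\<close>, and symmetry makes \<open>q\<close> its own conjugate.\<close>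

lemma symmetric_complex_eigenvalue_real:
  fixes M :: "real mat"
  assumes M: "M \<in> carrier_mat n n" and sym: "transpose_mat M = M"
    and ev: "eigenvalue (map_mat complex_of_real M) a"
  shows "a \<in> \<real>"
proof -
  obtain v where v: "v \<in> carrier_vec n" "v \<noteq> 0\<^sub>v n"
    and Mv: "map_mat complex_of_real M *\<^sub>v v = a \<cdot>\<^sub>v v"
    using ev M unfolding eigenvalue_def eigenvector_def by auto
  define q where "q = (\<Sum>i<n. \<Sum>j<n. complex_of_real (M $$ (i, j)) * v $ j * cnj (v $ i))"
  define s where "s = (\<Sum>i<n. (cmod (v $ i))\<^sup>2)"
  have symij: "M $$ (i, j) = M $$ (j, i)" if "i < n" "j < n" for i j
    using that M sym by (metis carrier_matD index_transpose_mat(1))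
  have row: "(\<Sum>j<n. complex_of_real (M $$ (i, j)) * v $ j) = a * v $ i" if "i < n" for i
    using arg_cong[OF Mv, of "\<lambda>w. w $ i"] that M v
    by (simp add: scalar_prod_def atLeast0LessThan)
  have "q = (\<Sum>i<n. (\<Sum>j<n. complex_of_real (M $$ (i, j)) * v $ j) * cnj (v $ i))"
    unfolding q_def by (simp add: sum_distrib_right)
  also have "\<dots> = (\<Sum>i<n. a * v $ i * cnj (v $ i))" by (simp add: row)
  also have "\<dots> = a * complex_of_real s"
    unfolding s_def by (simp add: sum_distrib_left mult.assoc complex_norm_square flip: of_real_power)
  finally have q: "q = a * complex_of_real s" .
  have "cnj q = (\<Sum>i<n. \<Sum>j<n. complex_of_real (M $$ (j, i)) * cnj (v $ j) * v $ i)"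
    unfolding q_def by (simp add: symij)
  also have "\<dots> = q" unfolding q_def by (subst sum.swap) (simp add: ac_simps)
  finally have "q \<in> \<real>" by (simp add: Reals_cnj_iff)
  obtain i where "i < n" "v $ i \<noteq> 0" using v by (metis carrier_vecD eq_vecI index_zero_vec)
  then have "s > 0" unfolding s_def by (intro sum_pos2[where i = i]) auto
  then have "a = q / complex_of_real s" using q by simp
  then show ?thesis using \<open>q \<in> \<real>\<close> by (simp add: Reals_divide)
qed

text \<open>The polynomial splits over the complex numbers and all its roots are real, so the
  factorisation is the image of a real one; injectivity of the embedding brings it back.\<close>

lemma symmetric_char_poly_factorized:
  fixes M :: "real mat"
  assumes M: "M \<in> carrier_mat n n" and sym: "transpose_mat M = M"
  shows "\<exists>as. char_poly M = (\<Prod>a\<leftarrow>as. [:- a, 1:]) \<and> length as = n"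
proof -
  interpret hom: map_poly_inj_comm_ring_hom complex_of_real ..
  let ?h = "map_poly complex_of_real"
  have Mc: "map_mat complex_of_real M \<in> carrier_mat n n" using M by simp
  obtain cs where cs: "char_poly (map_mat complex_of_real M) = (\<Prod>a\<leftarrow>cs. [:- a, 1:])" "length cs = n"
    using char_poly_factorized[OF Mc] by blast
  have "c \<in> \<real>" if "c \<in> set cs" for c
  proof -
    have "poly (char_poly (map_mat complex_of_real M)) c = 0"
      using that unfolding cs(1) poly_prod_list by (auto simp: prod_list_zero_iff)
    then show ?thesis
      using symmetric_complex_eigenvalue_real[OF M sym] eigenvalue_root_char_poly[OF Mc] by blast
  qed
  then have csR: "map (\<lambda>c. complex_of_real (Re c)) cs = cs" by (intro map_idI) auto
  have "?h (char_poly M) = (\<Prod>c\<leftarrow>map (\<lambda>c. complex_of_real (Re c)) cs. [:- c, 1:])"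
    unfolding csR cs(1)[symmetric] by (rule of_real_hom.char_poly_hom[OF M, symmetric])
  also have "\<dots> = ?h (\<Prod>a\<leftarrow>map Re cs. [:- a, 1:])"
    by (simp add: hom.hom_prod_list o_def)
  finally have "char_poly M = (\<Prod>a\<leftarrow>map Re cs. [:- a, 1:])" by simp
  then show ?thesis using cs(2) by (intro exI[of _ "map Re cs"]) simp
qed

lemma proots_linear_factors: "proots (\<Prod>a\<leftarrow>as. [:- a, 1:]) = mset (as :: 'a :: idom list)"
proof (induction as)
  case (Cons a as)
  have "(\<Prod>a\<leftarrow>as. [:- a, 1:]) \<noteq> (0 :: 'a poly)" by (auto simp: prod_list_zero_iff)
  then show ?case using Cons by (simp add: proots_mult del: mult_pCons_left)
qed simp

text \<open>The characteristic polynomial at 0 is the determinant of \<open>- M\<close>, and the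
  linear factors at 0 are the negated roots; the two signs \<open>(-1) ^ n\<close> cancel.\<close>

lemma det_eq_prod_roots:
  fixes M :: "'a :: idom mat"
  assumes M: "M \<in> carrier_mat n n" and fac: "char_poly M = (\<Prod>a\<leftarrow>as. [:- a, 1:])"
    and len: "length as = n"
  shows "det M = prod_list as"
proof -
  have "poly (char_poly M) 0 = det (- M)"
    unfolding char_poly_def by (rule poly_det_cong[of _ n]) (use M in \<open>auto simp: char_poly_matrix_def\<close>)
  also have "\<dots> = (-1) ^ n * det M"
  proof -
    have "- M = (-1) \<cdot>\<^sub>m M" by (intro eq_matI) auto
    then show ?thesis using M by simp
  qed
  finally have 1: "poly (char_poly M) 0 = (-1) ^ n * det M" .
  have "poly (\<Prod>a\<leftarrow>as. [:- a, 1:]) 0 = (-1) ^ length as * prod_list as"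
    by (induction as) auto
  then show ?thesis using 1 fac len by simp
qed

lemma length_eigvals_symmetric:
  assumes "M \<in> carrier_mat n n" "transpose_mat M = M"
  shows "length (eigvals M) = n"
  using symmetric_char_poly_factorized[OF assms] unfolding eigvals_def
  by (auto simp: proots_linear_factors simp flip: size_mset)

lemma prod_list_eigvals_symmetric:
  assumes "M \<in> carrier_mat n n" "transpose_mat M = M"
  shows "prod_list (eigvals M) = det M"
proof -
  obtain as where as: "char_poly M = (\<Prod>a\<leftarrow>as. [:- a, 1:])" "length as = n"
    using symmetric_char_poly_factorized[OF assms] by blast
  have "mset (eigvals M) = mset as" unfolding eigvals_def as(1) by (simp add: proots_linear_factors)
  then have "prod_list (eigvals M) = prod_list as" by (metis prod_mset_prod_list)
  then show ?thesis using det_eq_prod_roots[OF assms(1) as] by simp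
qed

text \<open>The powers of the indeterminate in \<open>char_poly_mult_swap\<close> contribute only
  roots 0, which the filter discards. The remaining multisets agree, and since
  \<open>eigvals\<close> is sorted, so do the lists.\<close>

lemma filter_eigvals_mult_swap:
  fixes X Y :: "real mat"
  assumes X: "X \<in> carrier_mat n m" and Y: "Y \<in> carrier_mat m n"
  shows "filter (\<lambda>x. x \<noteq> 0) (eigvals (X * Y)) = filter (\<lambda>x. x \<noteq> 0) (eigvals (Y * X))"
proof -
  have nz: "char_poly M \<noteq> 0" if "M \<in> carrier_mat k k" for M :: "real mat" and k
    using degree_monic_char_poly[OF that] by auto
  have nz: "char_poly (X * Y) \<noteq> 0" "char_poly (Y * X) \<noteq> 0"
    using nz[of "X * Y" n] nz[of "Y * X" m] X Y by auto
  have pr: "proots ([:0, 1:] ^ k * char_poly M)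
      = repeat_mset k {#0#} + proots (char_poly M)" if "char_poly M \<noteq> 0" for M :: "real mat" and k
    using that by (subst proots_mult) (auto simp: proots_power)
  have "repeat_mset m {#0#} + proots (char_poly (X * Y)) = repeat_mset n {#0#} + proots (char_poly (Y * X))"
    using arg_cong[OF char_poly_mult_swap[OF X Y], of proots] nz by (simp add: pr)
  then have "filter_mset (\<lambda>x. x \<noteq> 0) (repeat_mset m {#0#} + proots (char_poly (X * Y)))
     = filter_mset (\<lambda>x. x \<noteq> 0) (repeat_mset n {#0#} + proots (char_poly (Y * X)))" by (rule arg_cong)
  moreover have "filter_mset (\<lambda>x. x \<noteq> 0) (replicate_mset k (0 :: real)) = {#}" for k
    by (induction k) auto
  ultimately have "filter_mset (\<lambda>x. x \<noteq> 0) (proots (char_poly (X * Y)))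
     = filter_mset (\<lambda>x. x \<noteq> 0) (proots (char_poly (Y * X)))" by simp
  then have "mset (filter (\<lambda>x. x \<noteq> 0) (eigvals (X * Y))) = mset (filter (\<lambda>x. x \<noteq> 0) (eigvals (Y * X)))"
    unfolding eigvals_def by simp
  moreover have "sorted (filter (\<lambda>x. x \<noteq> 0) (eigvals M))" for M
    using sorted_filter[of "\<lambda>x. x" "eigvals M"] by (simp add: eigvals_def)
  ultimately show ?thesis
    by (metis sorted_list_of_multiset_mset sorted_sort_id)
qed

text \<open>Every index set of size \<open>r\<close> other than the set \<open>Z\<close> of nonzero
  positions contains a zero entry, so one summand survives.\<close>

lemma elem_sym_nonzero_length:
  assumes "length (filter (\<lambda>x. x \<noteq> 0) xs) = r"
  shows "elem_sym r xs = prod_list (filter (\<lambda>x. x \<noteq> 0) xs)"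
proof -
  define Z where "Z = {i. i < length xs \<and> xs ! i \<noteq> 0}"
  have cZ: "card Z = r" using assms unfolding Z_def by (simp add: length_filter_conv_card)
  have "(\<Prod>i\<in>S. xs ! i) = 0" if S: "S \<subseteq> {..<length xs}" "card S = r" "S \<noteq> Z" for S
  proof -
    have "finite Z" by (simp add: Z_def)
    then have "\<not> S \<subseteq> Z" using S cZ card_subset_eq by metis
    then obtain i where "i \<in> S" "xs ! i = 0" using S(1) by (auto simp: Z_def)
    then show ?thesis using S(1) finite_subset by (intro prod_zero) auto
  qed
  then have "elem_sym r xs = (\<Sum>S\<in>{Z}. \<Prod>i\<in>S. xs ! i)"
    unfolding elem_sym_def
    by (intro sum.mono_neutral_right) (use cZ in \<open>auto simp: Z_def\<close>)
  also have "\<dots> = (\<Prod>i<length xs. if xs ! i \<noteq> 0 then xs ! i else 1)"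
    unfolding Z_def by (simp add: prod.inter_filter[symmetric] lessThan_def)
  also have "\<dots> = prod_list (map (\<lambda>x. if x \<noteq> 0 then x else 1) xs)"
    by (simp add: prod.list_conv_set_nth atLeast0LessThan)
  also have "\<dots> = prod_list (filter (\<lambda>x. x \<noteq> 0) xs)" by (induction xs) auto
  finally show ?thesis .
qed

subsection \<open>Submatrices and weighted Gram determinants\<close>

lemma row_submatrix_carrier:
  assumes "M \<in> carrier_mat m n" "S \<subseteq> {..<m}"
  shows "row_submatrix M S \<in> carrier_mat (card S) n"
proof -
  \<comment> \<open>The dimensions of \<open>submatrix\<close> count the selected indices that lie
    in range; here these are all of \<open>S\<close>.\<close>
  have "{i. i < m \<and> i \<in> S} = S" using assms(2) by auto
  then show ?thesis using assms(1) unfolding row_submatrix_def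
    by (intro carrier_matI) (simp_all add: dim_submatrix)
qed

lemma pick_less:
  assumes "S \<subseteq> {..<m}" "i < card S"
  shows "pick S i < m"
  using pick_in_set[of i S, OF disjI1[OF assms(2)]] assms(1) by blast

lemma row_submatrix_index:
  assumes "M \<in> carrier_mat m n" "S \<subseteq> {..<m}" "i < card S" "j < n"
  shows "row_submatrix M S $$ (i, j) = M $$ (pick S i, j)"
proof -
  have "{i. i < m \<and> i \<in> S} = S" using assms(2) by auto
  then show ?thesis
    using assms(1,3,4) unfolding row_submatrix_def by (simp add: submatrix_index pick_UNIV)
qed

lemma principal_submatrix_carrier:
  assumes "M \<in> carrier_mat m m" "S \<subseteq> {..<m}"
  shows "principal_submatrix M S \<in> carrier_mat (card S) (card S)"
proof -
  have "{i. i < m \<and> i \<in> S} = S" using assms(2) by auto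
  then show ?thesis using assms(1) unfolding principal_submatrix_def
    by (intro carrier_matI) (simp_all add: dim_submatrix)
qed

lemma principal_submatrix_index:
  assumes "M \<in> carrier_mat m m" "S \<subseteq> {..<m}" "i < card S" "j < card S"
  shows "principal_submatrix M S $$ (i, j) = M $$ (pick S i, pick S j)"
proof -
  have "{i. i < m \<and> i \<in> S} = S" using assms(2) by auto
  then show ?thesis
    using assms(1,3,4) unfolding principal_submatrix_def by (simp add: submatrix_index)
qed

lemma submatrix_transpose:
  assumes "M \<in> carrier_mat m n" "S \<subseteq> {..<m}"
  shows "submatrix (transpose_mat M) UNIV S = transpose_mat (row_submatrix M S)"
proof -
  have S: "{i. i < m \<and> i \<in> S} = S" using assms(2) by auto
  show ?thesis
  proof (rule eq_matI, goal_cases)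
    case (1 i j)
    then have ij: "i < n" "j < card S" using row_submatrix_carrier[OF assms] by auto
    then have "submatrix (transpose_mat M) UNIV S $$ (i, j) = transpose_mat M $$ (i, pick S j)"
      using assms(1) S by (simp add: submatrix_index pick_UNIV)
    then show ?case
      using ij assms pick_less[OF assms(2) ij(2)] row_submatrix_carrier[OF assms]
      by (simp add: row_submatrix_index)
  qed (use assms(1) S row_submatrix_carrier[OF assms] in \<open>simp_all add: dim_submatrix\<close>)
qed

lemma row_submatrix_mult:
  assumes M: "M \<in> carrier_mat m n" and D: "D \<in> carrier_mat n k" and S: "S \<subseteq> {..<m}"
  shows "row_submatrix (M * D) S = row_submatrix M S * D"
proof -
  have car: "row_submatrix M S \<in> carrier_mat (card S) n" "row_submatrix (M * D) S \<in> carrier_mat (card S) k"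
    using row_submatrix_carrier[OF M S] row_submatrix_carrier[OF mult_carrier_mat[OF M D] S] .
  show ?thesis
  proof (rule eq_matI, goal_cases)
    case (1 i j)
    then have ij: "i < card S" "j < k" using car D by auto
    then have "row (row_submatrix M S) i = row M (pick S i)"
      using car M S pick_less[OF S ij(1)] by (intro eq_vecI) (auto simp: row_submatrix_index[OF M S])
    then show ?case
      using ij M D car pick_less[OF S ij(1)] by (simp add: row_submatrix_index[OF mult_carrier_mat[OF M D] S])
  qed (use car D in auto)
qed

text \<open>Used for two matrices: \<open>X = M\<close> gives the minors of the row Gram matrix, and
  \<open>X = M * Wi\<close> gives those of the marginal kernel.\<close>

lemma principal_submatrix_mult_transpose:
  assumes M: "M \<in> carrier_mat m n" and X: "X \<in> carrier_mat m n" and S: "S \<subseteq> {..<m}"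
  shows "principal_submatrix (X * transpose_mat M) S
    = row_submatrix X S * transpose_mat (row_submatrix M S)"
proof -
  have car: "row_submatrix M S \<in> carrier_mat (card S) n" "row_submatrix X S \<in> carrier_mat (card S) n"
     "principal_submatrix (X * transpose_mat M) S \<in> carrier_mat (card S) (card S)"
    using row_submatrix_carrier[OF M S] row_submatrix_carrier[OF X S]
      principal_submatrix_carrier[OF mult_carrier_mat[OF X transpose_carrier_mat[THEN iffD2, OF M]] S] .
  show ?thesis
  proof (rule eq_matI, goal_cases)
    case (1 i j)
    then have ij: "i < card S" "j < card S" using car by auto
    then have "row (row_submatrix M S) j = row M (pick S j)" "row (row_submatrix X S) i = row X (pick S i)"
      using car M X S pick_less[OF S]
      by (auto intro!: eq_vecI simp: row_submatrix_index[OF M S] row_submatrix_index[OF X S])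
    then show ?case
      using ij M X car pick_less[OF S]
      by (simp add: principal_submatrix_index[OF mult_carrier_mat[OF X transpose_carrier_mat[THEN iffD2, OF M]] S])
  qed (use car in auto)
qed

lemma row_gram_eq:
  "row_gram M = M * transpose_mat M"
  unfolding row_gram_def by (intro eq_matI) auto

text \<open>With \<open>card S = n\<close> the selected rows form a square matrix, so the
  determinant of the product splits.\<close>

lemma det_principal_row_gram:
  assumes M: "M \<in> carrier_mat m n" and S: "S \<subseteq> {..<m}" "card S = n"
  shows "det (principal_submatrix (row_gram M) S) = (det (row_submatrix M S))\<^sup>2"
  unfolding row_gram_eq principal_submatrix_mult_transpose[OF M M S(1)]
  using row_submatrix_carrier[OF M S(1)] S(2)
  by (simp add: det_mult[of _ n] det_transpose[of _ n] power2_eq_square)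

lemma cauchy_binet_weighted:
  fixes M :: "'a :: idom mat"
  assumes M: "M \<in> carrier_mat m n"
  shows "det (transpose_mat M * (mat_diag m z * M))
    = (\<Sum>S | S \<subseteq> {..<m} \<and> card S = n. (\<Prod>i\<in>S. z i) * (det (row_submatrix M S))\<^sup>2)"
proof -
  have zM: "mat_diag m z * M \<in> carrier_mat m n" by (rule mult_carrier_mat[OF mat_diag_dim M])
  have "det (submatrix (transpose_mat M) UNIV S) * det (submatrix (mat_diag m z * M) S UNIV)
    = (\<Prod>i\<in>S. z i) * (det (row_submatrix M S))\<^sup>2" if S: "S \<subseteq> {..<m}" "card S = n" for S
  proof -
    have car: "row_submatrix M S \<in> carrier_mat n n" "row_submatrix (mat_diag m z * M) S \<in> carrier_mat n n"
      using row_submatrix_carrier[OF _ S(1)] M zM S(2) by auto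
    \<comment> \<open>Selecting rows restricts the diagonal weight to \<open>S\<close>, renumbered
      by position.\<close>
    have "row_submatrix (mat_diag m z * M) S = mat_diag n (\<lambda>i. z (pick S i)) * row_submatrix M S"
    proof (rule eq_matI, goal_cases)
      case (1 i j)
      then have ij: "i < n" "j < n" using car by (simp_all add: mat_diag_def)
      then show ?case using M zM S car pick_less[OF S(1), of i]
        by (simp add: row_submatrix_index[of _ m n] mat_diag_mult_left[of _ _ n])
    qed (use car in \<open>auto simp: mat_diag_def\<close>)
    moreover have "det (mat_diag n (\<lambda>i. z (pick S i))) = (\<Prod>i\<in>S. z i)"
    proof -
      have "det (mat_diag n (\<lambda>i. z (pick S i))) = prod_list (diag_mat (mat_diag n (\<lambda>i. z (pick S i))))"
        by (rule det_upper_triangular[of _ n]) (auto simp: mat_diag_def)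
      also have "\<dots> = (\<Prod>i = 0..<n. z (pick S i))"
        by (simp add: prod_list_diag_prod mat_diag_def)
      also have "\<dots> = (\<Prod>i\<in>S. z i)"
        using bij_betw_pick[of S] S finite_subset[of S "{..<m}"] by (intro prod.reindex_bij_betw) auto
      finally show ?thesis .
    qed
    ultimately have "det (row_submatrix (mat_diag m z * M) S) = (\<Prod>i\<in>S. z i) * det (row_submatrix M S)"
      using det_mult[OF mat_diag_dim car(1)] by simp
    then show ?thesis
      unfolding submatrix_transpose[OF M S(1)] det_transpose[OF car(1)]
      by (simp add: row_submatrix_def power2_eq_square)
  qed
  moreover have MT: "transpose_mat M \<in> carrier_mat n m" using M by simp
  ultimately show ?thesis unfolding cauchy_binet[OF MT zM] by (intro sum.cong) auto
qed

lemma cauchy_binet_gram: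
  fixes M :: "'a :: idom mat"
  assumes M: "M \<in> carrier_mat m n"
  shows "det (transpose_mat M * M) = (\<Sum>S | S \<subseteq> {..<m} \<and> card S = n. (det (row_submatrix M S))\<^sup>2)"
proof -
  have "mat_diag m (\<lambda>_. 1) * M = M" using M by (simp add: mat_diag_one)
  then show ?thesis using cauchy_binet_weighted[OF M, of "\<lambda>_. 1"] by simp
qed

lemma transpose_weighted_gram_index:
  fixes M :: "'a :: comm_semiring_1 mat"
  assumes M: "M \<in> carrier_mat m n" and ij: "i < n" "j < n"
  shows "(transpose_mat M * (mat_diag m z * M)) $$ (i, j) = (\<Sum>r<m. z r * M $$ (r, i) * M $$ (r, j))"
  using M ij by (simp add: mat_diag_mult_left[OF M] scalar_prod_def atLeast0LessThan ac_simps)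

lemma row_submatrix_gram_index:
  fixes M :: "'a :: comm_semiring_1 mat"
  assumes M: "M \<in> carrier_mat m n" and S: "S \<subseteq> {..<m}" and ij: "i < n" "j < n"
  shows "(transpose_mat (row_submatrix M S) * row_submatrix M S) $$ (i, j)
    = (\<Sum>r\<in>S. M $$ (r, i) * M $$ (r, j))"
proof -
  have "(transpose_mat (row_submatrix M S) * row_submatrix M S) $$ (i, j)
    = (\<Sum>k = 0..<card S. M $$ (pick S k, i) * M $$ (pick S k, j))"
    using row_submatrix_carrier[OF M S] ij
    by (simp add: scalar_prod_def row_submatrix_index[OF M S])
  also have "\<dots> = (\<Sum>r\<in>S. M $$ (r, i) * M $$ (r, j))"
    using bij_betw_pick finite_subset[OF S] by (intro sum.reindex_bij_betw) auto
  finally show ?thesis .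
qed

text \<open>The left side is \<open>F 0\<close> and the right side is \<open>G 0\<close>. For
  \<open>s \<noteq> 0\<close> a weighted Gram determinant shows \<open>F s = G s\<close>, and
  continuity carries the equality to 0.\<close>

lemma sum_det_superset:
  fixes M :: "real mat"
  assumes M: "M \<in> carrier_mat m n" and Wi: "Wi \<in> carrier_mat n n"
    and inv: "transpose_mat M * M * Wi = 1\<^sub>m n"
    and A: "A \<subseteq> {..<m}"
  shows "(\<Sum>S | S \<subseteq> {..<m} \<and> card S = n \<and> A \<subseteq> S. (det (row_submatrix M S))\<^sup>2)
    = det (transpose_mat M * M) * det (principal_submatrix (M * Wi * transpose_mat M) A)"
proof -
  define W where "W = transpose_mat M * M"
  define R where "R = row_submatrix M A"
  define K where "K = R * Wi * transpose_mat R"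
  define a where "a = card A"
  define Sub where "Sub = {S. S \<subseteq> {..<m} \<and> card S = n}"
  have finA: "finite A" using A finite_subset by auto
  have finSub: "finite Sub" by (rule finite_subset[of _ "Pow {..<m}"]) (auto simp: Sub_def)
  have W: "W \<in> carrier_mat n n" unfolding W_def using M by simp
  have R: "R \<in> carrier_mat a n" unfolding R_def a_def by (rule row_submatrix_carrier[OF M A])
  have K: "K \<in> carrier_mat a a" unfolding K_def using R Wi by simp
  have K_eq: "principal_submatrix (M * Wi * transpose_mat M) A = K"
    using principal_submatrix_mult_transpose[OF M _ A, of "M * Wi"] row_submatrix_mult[OF M Wi A] M Wi
    unfolding K_def R_def by simp
  define F where "F s = (\<Sum>S\<in>Sub. s ^ card (A - S) * (det (row_submatrix M S))\<^sup>2)" for s :: real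
  \<comment> \<open>This is s I + (1 - s) K, written entrywise so that the limit can be taken in
    each entry.\<close>
  define Ks where "Ks s = mat a a (\<lambda>(i, j). (if i = j then s else 0) + (1 - s) * K $$ (i, j))" for s
  have Ks: "Ks s \<in> carrier_mat a a" for s unfolding Ks_def by simp
  define G where "G s = det W * det (Ks s)" for s
  have FG: "F s = G s" if s: "s \<noteq> 0" for s
  proof -
    define z where "z i = (if i \<in> A then 1 / s else 1)" for i
    \<comment> \<open>\<open>inv\<close> gives \<open>W * X = transpose_mat R\<close>, so
      \<open>W * (1\<^sub>m n - X * Y)\<close> is \<open>W\<close> minus \<open>1 - 1 / s\<close>
      times the Gram matrix of the rows in \<open>A\<close>. That is the weighted Gram matrix, since
      \<open>z i\<close> falls short of 1 by exactly \<open>1 - 1 / s\<close> on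
      \<open>A\<close>.\<close>
    define X where "X = Wi * transpose_mat R"
    define Y where "Y = (1 - 1 / s) \<cdot>\<^sub>m R"
    have X: "X \<in> carrier_mat n a" and Y: "Y \<in> carrier_mat a n"
      unfolding X_def Y_def using Wi R by auto
    \<comment> \<open>Each element of \<open>A \<inter> S\<close> cancels one of the
      \<open>a\<close> factors \<open>s\<close>.\<close>
    have "s ^ a * (\<Prod>i\<in>S. z i) = s ^ card (A - S)" if "S \<in> Sub" for S
    proof -
      have "finite S" using that finite_subset unfolding Sub_def by auto
      then have "(\<Prod>i\<in>S. z i) = (1 / s) ^ card (A \<inter> S)"
        unfolding z_def by (simp add: prod.If_cases Int_commute)
      moreover have "a = card (A - S) + card (A \<inter> S)"
        unfolding a_def using card_Diff_subset_Int[of A S] finA card_mono[of A "A \<inter> S"] by simp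
      ultimately show ?thesis using s by (simp add: power_add power_divide)
    qed
    then have "F s = s ^ a * det (transpose_mat M * (mat_diag m z * M))"
      unfolding F_def cauchy_binet_weighted[OF M] sum_distrib_left Sub_def[symmetric]
      by (intro sum.cong) (auto simp flip: mult.assoc)
    also have "transpose_mat M * (mat_diag m z * M) = W * (1\<^sub>m n - X * Y)"
    proof -
      have "W * (X * Y) = (1 - 1 / s) \<cdot>\<^sub>m (transpose_mat R * R)"
      proof -
        have "W * (X * Y) = (W * Wi) * (transpose_mat R * Y)"
          unfolding X_def using W Wi R Y
          by (simp add: assoc_mult_mat[of _ n n _ n _ n] assoc_mult_mat[of _ n n _ a _ n])
        then show ?thesis using inv R unfolding W_def Y_def
          by (simp add: mult_smult_distrib[of _ n a])
      qed
      then have *: "W * (1\<^sub>m n - X * Y) = W - (1 - 1 / s) \<cdot>\<^sub>m (transpose_mat R * R)"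
        using mult_minus_distrib_mat[OF W one_carrier_mat, of "X * Y"] W X Y by simp
      show ?thesis unfolding *
      proof (rule eq_matI, goal_cases)
        case (1 i j)
        then have ij: "i < n" "j < n" using R by auto
        have "(transpose_mat M * (mat_diag m z * M)) $$ (i, j) = (\<Sum>r<m. z r * M $$ (r, i) * M $$ (r, j))"
          by (rule transpose_weighted_gram_index[OF M ij])
        also have "\<dots> = (\<Sum>r<m. M $$ (r, i) * M $$ (r, j)
            - (if r \<in> A then (1 - 1 / s) * (M $$ (r, i) * M $$ (r, j)) else 0))"
          unfolding z_def by (intro sum.cong) (auto simp: algebra_simps)
        also have "\<dots> = (\<Sum>r<m. M $$ (r, i) * M $$ (r, j))
            - (1 - 1 / s) * (\<Sum>r\<in>A. M $$ (r, i) * M $$ (r, j))"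
          unfolding sum_subtractf sum_distrib_left
          using A by (simp add: sum.If_cases Int_absorb1)
        also have "(\<Sum>r<m. M $$ (r, i) * M $$ (r, j)) = W $$ (i, j)"
          unfolding W_def using M ij by (simp add: scalar_prod_def atLeast0LessThan)
        also have "(\<Sum>r\<in>A. M $$ (r, i) * M $$ (r, j)) = (transpose_mat R * R) $$ (i, j)"
          unfolding R_def using row_submatrix_gram_index[OF M A ij] by simp
        finally show ?case using ij W R by simp
      qed (use M R in auto)
    qed
    also have "det \<dots> = det W * det (1\<^sub>m n - X * Y)"
      using W X Y by (intro det_mult[of _ n]) auto
    also have "det (1\<^sub>m n - X * Y) = det (1\<^sub>m a - Y * X)"
    proof -
      have "(1 :: real) \<cdot>\<^sub>m 1\<^sub>m k = 1\<^sub>m k" for k by (intro eq_matI) auto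
      then show ?thesis using det_smult_one_minus_mult_swap[OF X Y, of 1] by simp
    qed
    also have "Y * X = (1 - 1 / s) \<cdot>\<^sub>m K"
      unfolding X_def Y_def K_def using R Wi
      by (simp add: mult_smult_assoc_mat[OF R, of "Wi * transpose_mat R" a] assoc_mult_mat[of _ a n _ n _ a])
    \<comment> \<open>One factor \<open>s\<close> goes into each of the \<open>a\<close> rows;
      \<open>s * (1 - 1 / s) = s - 1\<close> then removes the pole.\<close>
    also have "s ^ a * (det W * det (1\<^sub>m a - (1 - 1 / s) \<cdot>\<^sub>m K))
      = det W * det (s \<cdot>\<^sub>m (1\<^sub>m a - (1 - 1 / s) \<cdot>\<^sub>m K))"
      using K by simp
    also have "s \<cdot>\<^sub>m (1\<^sub>m a - (1 - 1 / s) \<cdot>\<^sub>m K) = Ks s"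
      unfolding Ks_def using K s by (intro eq_matI) (auto simp: field_simps)
    finally show ?thesis unfolding G_def .
  qed
  have "(F \<longlongrightarrow> F 0) (at 0)" unfolding F_def by (intro tendsto_intros)
  moreover have "(G \<longlongrightarrow> G 0) (at 0)"
  proof -
    \<comment> \<open>By the Leibniz formula the determinant is polynomial in the entries, so
      entrywise limits suffice.\<close>
    have "((\<lambda>s. Ks s $$ (i, j)) \<longlongrightarrow> Ks 0 $$ (i, j)) (at 0)" if "i < a" "j < a" for i j
      unfolding Ks_def using that by (cases "i = j") (auto intro!: tendsto_eq_intros)
    then have "((\<lambda>s. Ks s $$ (i, p i)) \<longlongrightarrow> Ks 0 $$ (i, p i)) (at 0)"
      if "p permutes {0..<a}" "i \<in> {0..<a}" for p i
      using that permutes_in_image[OF that(1), of i] by auto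
    then have "((\<lambda>s. det (Ks s)) \<longlongrightarrow> det (Ks 0)) (at 0)"
      unfolding det_def'[OF Ks] by (auto intro!: tendsto_intros)
    then show ?thesis unfolding G_def by (intro tendsto_intros)
  qed
  \<comment> \<open>The filter \<open>at 0\<close> ignores the point 0, the only one at which
    \<open>FG\<close> is silent.\<close>
  moreover have "(F \<longlongrightarrow> G 0) (at 0) \<longleftrightarrow> (G \<longlongrightarrow> G 0) (at 0)"
    by (rule tendsto_cong) (auto simp: eventually_at FG intro!: exI[of _ 1])
  ultimately have "F 0 = G 0"
    using tendsto_unique[of "at (0 :: real)"] by (simp add: trivial_limit_at)
  moreover have "Ks 0 = K" unfolding Ks_def using K by (intro eq_matI) auto
  moreover have "F 0 = (\<Sum>S\<in>{S\<in>Sub. A \<subseteq> S}. (det (row_submatrix M S))\<^sup>2)"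
  proof -
    \<comment> \<open>Since \<open>0 ^ 0 = 1\<close>, the power is nonzero exactly when
      \<open>A - S\<close> is empty.\<close>
    have "(0::real) ^ card (A - S) = (if A \<subseteq> S then 1 else 0)" for S
      using finA by (auto simp: power_0_left)
    then show ?thesis unfolding F_def using finSub
      by (subst sum.inter_filter) (auto intro: sum.cong)
  qed
  moreover have "{S\<in>Sub. A \<subseteq> S} = {S. S \<subseteq> {..<m} \<and> card S = n \<and> A \<subseteq> S}" by (auto simp: Sub_def)
  ultimately show ?thesis unfolding K_eq G_def W_def by simp
qed

subsection \<open>Full column rank\<close>

text \<open>Independence concerns the set of columns, in which repetitions collapse, so the columns
  must first be shown distinct. A repetition would leave fewer than \<open>n\<close> elements in
  that set, while the rank is the size of a maximal independent subset.\<close>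

lemma full_column_rank_kernel:
  fixes M :: "'a :: field mat"
  assumes M: "M \<in> carrier_mat m n" and rank: "vec_space.rank m M = n"
    and v: "v \<in> carrier_vec n" and Mv: "M *\<^sub>v v = 0\<^sub>v m"
  shows "v = 0\<^sub>v n"
proof (rule ccontr)
  assume nz: "v \<noteq> 0\<^sub>v n"
  interpret vec_space "TYPE('a)" m .
  have "distinct (cols M)"
  proof (rule ccontr)
    assume nd: "\<not> distinct (cols M)"
    obtain S where S: "maximal S (\<lambda>T. T \<subseteq> set (cols M) \<and> lin_indpt T)"
      using maximal_exists[of "\<lambda>T. T \<subseteq> set (cols M) \<and> lin_indpt T" "card (set (cols M))" "{}"]
      by (meson List.finite_set card_mono empty_iff empty_subsetI finite_lin_indpt2 rev_finite_subset)
    then have "card S \<le> card (set (cols M))" by (simp add: card_mono maximal_def)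
    moreover have "card (set (cols M)) < length (cols M)"
      using nd card_distinct card_length by (metis le_neq_implies_less)
    ultimately show False using rank_card_indpt[OF M S] rank M by simp
  qed
  then show False
    using full_rank_lin_indpt[OF M rank] lin_depI[OF M v nz Mv] by blast
qed

text \<open>The quadratic form at \<open>v\<close> is the squared length of
  \<open>M *\<^sub>v v\<close>, which vanishes only for \<open>v = 0\<close>.\<close>

lemma pos_def_gram:
  assumes M: "M \<in> carrier_mat m n" and rank: "vec_space.rank m M = n"
  shows "pos_def_mat (transpose_mat M * M)"
proof -
  have W: "transpose_mat M * M \<in> carrier_mat n n" using M by simp
  have "0 < v \<bullet> (transpose_mat M * M *\<^sub>v v)" if v: "v \<in> carrier_vec n" "v \<noteq> 0\<^sub>v n" for v
  proof -
    let ?w = "M *\<^sub>v v"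
    have w: "?w \<in> carrier_vec m" using M v by simp
    have "?w \<noteq> 0\<^sub>v m" using full_column_rank_kernel[OF M rank v(1)] v(2) by blast
    then obtain i where i: "i < m" "?w $ i \<noteq> 0" using w by (metis carrier_vecD eq_vecI index_zero_vec)
    have "v \<bullet> (transpose_mat M * M *\<^sub>v v) = v \<bullet> (transpose_mat M *\<^sub>v ?w)"
      using M v by (simp add: assoc_mult_mat_vec[of _ n m])
    also have "\<dots> = ?w \<bullet> ?w"
      using transpose_vec_mult_scalar[OF M v(1) w] M v w
      by (metis comm_scalar_prod mult_mat_vec_carrier transpose_carrier_mat)
    also have "\<dots> = (\<Sum>k = 0..<m. (?w $ k)\<^sup>2)"
      using w M by (simp add: scalar_prod_def power2_eq_square del: index_mult_mat_vec)
    also have "\<dots> > 0" using i by (intro sum_pos2[of _ i]) auto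
    finally show ?thesis .
  qed
  moreover have "transpose_mat (transpose_mat M * M) = transpose_mat M * M"
    using M by (simp add: transpose_mult[of _ n m])
  ultimately show ?thesis using W unfolding pos_def_mat_def by auto
qed

lemma pos_def_det_nonzero:
  assumes "pos_def_mat W"
  shows "det W \<noteq> 0"
proof
  assume "det W = 0"
  then obtain v where v: "v \<in> carrier_vec (dim_row W)" "v \<noteq> 0\<^sub>v (dim_row W)" "W *\<^sub>v v = 0\<^sub>v (dim_row W)"
    using det_0_iff_vec_prod_zero assms unfolding pos_def_mat_def by blast
  then have "0 < v \<bullet> (W *\<^sub>v v)" using assms unfolding pos_def_mat_def by blast
  then show False using v by simp
qed

text \<open>A nonzero determinant rules out the result \<open>None\<close>, so \<open>the\<close>
  returns a genuine two-sided inverse.\<close>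

lemma mat_inverse_det_nonzero:
  fixes W :: "'a :: field mat"
  assumes W: "W \<in> carrier_mat n n" and det: "det W \<noteq> 0"
  shows "the (mat_inverse W) \<in> carrier_mat n n"
    "W * the (mat_inverse W) = 1\<^sub>m n" "the (mat_inverse W) * W = 1\<^sub>m n"
proof -
  obtain B where "mat_inverse W = Some B"
    using mat_inverse(1)[OF W] det_non_zero_imp_unit[OF W det] by fastforce
  then show "the (mat_inverse W) \<in> carrier_mat n n"
    "W * the (mat_inverse W) = 1\<^sub>m n" "the (mat_inverse W) * W = 1\<^sub>m n"
    using mat_inverse(2)[OF W] by auto
qed

lemma orthogonal_projection_gram_inverse:
  fixes M Wi :: "real mat"
  assumes M: "M \<in> carrier_mat m n" and Wi: "Wi \<in> carrier_mat n n"
    and inv: "transpose_mat M * M * Wi = 1\<^sub>m n" "Wi * (transpose_mat M * M) = 1\<^sub>m n"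
  shows "orthogonal_projection_mat (M * Wi * transpose_mat M)"
proof -
  define W where "W = transpose_mat M * M"
  have MT: "transpose_mat M \<in> carrier_mat n m" and W: "W \<in> carrier_mat n n"
    using M by (auto simp: W_def)
  have K: "M * Wi * transpose_mat M \<in> carrier_mat m m" using M Wi by simp
  have WT: "transpose_mat W = W" unfolding W_def using M by (simp add: transpose_mult[of _ n m])
  \<comment> \<open>Symmetry passes from \<open>W\<close> to its inverse: the product is regrouped
    so that \<open>Wi * W\<close> appears transposed.\<close>
  have "transpose_mat Wi = Wi * W * transpose_mat Wi"
    using inv(2) Wi by (simp add: W_def)
  also have "\<dots> = Wi * transpose_mat (Wi * W)"
    using transpose_mult[OF Wi W] WT W Wi by (simp add: assoc_mult_mat[of _ n n _ n _ n])
  also have "\<dots> = Wi" using inv(2) Wi by (simp add: W_def)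
  finally have WiT: "transpose_mat Wi = Wi" .
  have "transpose_mat (M * Wi * transpose_mat M) = M * Wi * transpose_mat M"
    using transpose_mult[OF mult_carrier_mat[OF M Wi] MT] transpose_mult[OF M Wi] WiT
      assoc_mult_mat[OF M Wi MT] by simp
  moreover have "M * Wi * transpose_mat M * (M * Wi * transpose_mat M) = M * Wi * transpose_mat M"
  proof -
    \<comment> \<open>Idempotence: the inner factor \<open>transpose_mat M * M\<close> is
      \<open>W\<close>, which cancels against \<open>Wi\<close>.\<close>
    have "M * Wi * transpose_mat M * (M * Wi * transpose_mat M)
      = M * Wi * ((W * Wi) * transpose_mat M)"
      unfolding W_def using M Wi MT
      by (simp add: assoc_mult_mat[of _ m n _ m _ m] assoc_mult_mat[of _ m n _ n _ m]
        assoc_mult_mat[of _ n n _ m _ m] assoc_mult_mat[of _ n m _ n _ n] assoc_mult_mat[of _ n m _ n _ m] assoc_mult_mat[of _ n n _ n _ m])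
    then show ?thesis using inv(1) MT by (simp add: W_def)
  qed
  ultimately show ?thesis unfolding orthogonal_projection_mat_def using K by auto
qed

subsection \<open>The k-DPP of a row Gram matrix\<close>

context
  fixes M :: "real mat" and m n :: nat
  assumes M: "M \<in> carrier_mat m n" and det: "det (transpose_mat M * M) \<noteq> 0"
begin

lemma eigvals_gram_nonzero: "0 \<notin> set (eigvals (transpose_mat M * M))"
proof -
  have "transpose_mat (transpose_mat M * M) = transpose_mat M * M"
    using M by (simp add: transpose_mult[of _ n m])
  then have "prod_list (eigvals (transpose_mat M * M)) \<noteq> 0"
    using prod_list_eigvals_symmetric[of "transpose_mat M * M" n] M det by simp
  then show ?thesis by (simp add: prod_list_zero_iff)
qed

text \<open>Both orders of the product have the same nonzero eigenvalues, and on the smaller side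
  none is zero, so the filter there has no effect.\<close>

lemma filter_eigvals_row_gram:
  "filter (\<lambda>x. x \<noteq> 0) (eigvals (row_gram M)) = eigvals (transpose_mat M * M)"
proof -
  have "filter (\<lambda>x. x \<noteq> 0) (eigvals (row_gram M)) = filter (\<lambda>x. x \<noteq> 0) (eigvals (transpose_mat M * M))"
    unfolding row_gram_eq by (rule filter_eigvals_mult_swap[OF M]) (use M in simp)
  also have "\<dots> = eigvals (transpose_mat M * M)"
    using eigvals_gram_nonzero by (intro filter_True) auto
  finally show ?thesis .
qed

lemma length_eigvals_gram:
  "length (eigvals (row_gram M)) = m" "length (eigvals (transpose_mat M * M)) = n"
  unfolding row_gram_eq using M
  by (simp_all add: length_eigvals_symmetric transpose_mult[of _ n m] transpose_mult[of _ m n])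

lemma elem_sym_eigvals_row_gram: "elem_sym n (eigvals (row_gram M)) = det (transpose_mat M * M)"
proof -
  have "elem_sym n (eigvals (row_gram M)) = prod_list (eigvals (transpose_mat M * M))"
    using elem_sym_nonzero_length[of "eigvals (row_gram M)" n] length_eigvals_gram(2)
    unfolding filter_eigvals_row_gram by simp
  also have "\<dots> = det (transpose_mat M * M)"
    using M by (intro prod_list_eigvals_symmetric[of _ n]) (simp_all add: transpose_mult[of _ n m])
  finally show ?thesis .
qed

text \<open>Cauchy--Binet writes the determinant as a sum of squares. Positivity is what makes the
  weights of the k-DPP nonnegative.\<close>

lemma det_gram_pos: "det (transpose_mat M * M) > 0"
proof -
  have "det (transpose_mat M * M) \<ge> 0" unfolding cauchy_binet_gram[OF M] by (intro sum_nonneg) simp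
  then show ?thesis using det by simp
qed

lemma finite_card_subsets: "finite {S. S \<subseteq> {..<m} \<and> card S = n}"
  by (rule finite_subset[of _ "Pow {..<m}"]) auto

text \<open>\<open>embed_pmf\<close> returns the intended masses once the function is nonnegative
  with total mass 1; the mass is computed by \<open>cauchy_binet_gram\<close>.\<close>

lemma pmf_kdpp_row_gram:
  "pmf (kdpp (row_gram M) n) S =
    (if S \<subseteq> {..<m} \<and> card S = n then (det (row_submatrix M S))\<^sup>2 / det (transpose_mat M * M) else 0)"
proof -
  define f where "f S = (if S \<subseteq> {..<m} \<and> card S = n
    then (det (row_submatrix M S))\<^sup>2 / det (transpose_mat M * M) else 0)" for S
  have "dim_row (row_gram M) = m" using M by (simp add: row_gram_def)
  then have "kdpp (row_gram M) n = embed_pmf f"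
    unfolding kdpp_def f_def elem_sym_eigvals_row_gram
    using det_principal_row_gram[OF M] by (intro arg_cong[where f = embed_pmf]) auto
  moreover have "pmf (embed_pmf f) S = f S"
  proof (rule pmf_embed_pmf)
    show f0: "0 \<le> f S" for S using det_gram_pos by (simp add: f_def)
    let ?Sub = "{S. S \<subseteq> {..<m} \<and> card S = n}"
    have "(\<integral>\<^sup>+S. ennreal (f S) \<partial>count_space UNIV) = (\<Sum>S\<in>?Sub. ennreal (f S))"
      by (rule nn_integral_count_space'[OF finite_card_subsets]) (auto simp: f_def)
    also have "\<dots> = ennreal (\<Sum>S\<in>?Sub. f S)" by (intro sum_ennreal f0)
    also have "(\<Sum>S\<in>?Sub. f S) = (\<Sum>S\<in>?Sub. (det (row_submatrix M S))\<^sup>2) / det (transpose_mat M * M)"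
      unfolding f_def sum_divide_distrib by (intro sum.cong) auto
    also have "\<dots> = 1" using det unfolding cauchy_binet_gram[OF M] by simp
    finally show "(\<integral>\<^sup>+S. ennreal (f S) \<partial>count_space UNIV) = 1" by simp
  qed
  ultimately show ?thesis unfolding f_def by simp
qed

lemma set_pmf_kdpp_row_gram: "set_pmf (kdpp (row_gram M) n) \<subseteq> {S. S \<subseteq> {..<m} \<and> card S = n}"
  by (auto simp: set_pmf_iff pmf_kdpp_row_gram split: if_splits)

lemma prob_kdpp_row_gram:
  "measure_pmf.prob (kdpp (row_gram M) n) E =
    (\<Sum>S | S \<subseteq> {..<m} \<and> card S = n \<and> S \<in> E. (det (row_submatrix M S))\<^sup>2) / det (transpose_mat M * M)"
proof -
  let ?P = "kdpp (row_gram M) n" and ?T = "{S. S \<subseteq> {..<m} \<and> card S = n \<and> S \<in> E}"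
  have "finite ?T" by (rule finite_subset[OF _ finite_card_subsets]) auto
  \<comment> \<open>Passing through the support replaces the arbitrary event \<open>E\<close> by the
    finite set \<open>?T\<close>.\<close>
  have "measure_pmf.prob ?P E = measure_pmf.prob ?P (E \<inter> set_pmf ?P)"
    by (simp add: measure_Int_set_pmf)
  also have "\<dots> = measure_pmf.prob ?P (?T \<inter> set_pmf ?P)"
    using set_pmf_kdpp_row_gram by (intro arg_cong[where f = "measure_pmf.prob ?P"]) auto
  also have "\<dots> = (\<Sum>S\<in>?T. pmf ?P S)"
    using \<open>finite ?T\<close> by (simp add: measure_Int_set_pmf measure_measure_pmf_finite)
  also have "\<dots> = (\<Sum>S\<in>?T. (det (row_submatrix M S))\<^sup>2 / det (transpose_mat M * M))"
    by (intro sum.cong) (auto simp: pmf_kdpp_row_gram)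
  finally show ?thesis by (simp add: sum_divide_distrib)
qed

text \<open>A product of indicator weights over \<open>S\<close> is the indicator of
  \<open>S \<subseteq> T\<close>, so the weighted sum keeps exactly the wanted sets.\<close>

lemma prob_kdpp_subset:
  "measure_pmf.prob (kdpp (row_gram M) n) {S. S \<subseteq> T} =
    det (transpose_mat M * (mat_diag m (\<lambda>i. if i \<in> T then 1 else 0) * M)) / det (transpose_mat M * M)"
proof -
  let ?z = "\<lambda>i. if i \<in> T then 1 else 0 :: real"
  have "(\<Prod>i\<in>S. ?z i) = (if S \<subseteq> T then 1 else 0)" if "S \<subseteq> {..<m}" for S
  proof -
    have fin: "finite S" using that finite_subset by blast
    show ?thesis
    proof (cases "S \<subseteq> T")
      case False
      then show ?thesis using fin by (auto intro!: prod_zero)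
    qed (auto intro!: prod.neutral)
  qed
  then have "det (transpose_mat M * (mat_diag m ?z * M))
      = (\<Sum>S | S \<subseteq> {..<m} \<and> card S = n. if S \<subseteq> T then (det (row_submatrix M S))\<^sup>2 else 0)"
    unfolding cauchy_binet_weighted[OF M] by (intro sum.cong) auto
  also have "\<dots> = (\<Sum>S | S \<subseteq> {..<m} \<and> card S = n \<and> S \<subseteq> T. (det (row_submatrix M S))\<^sup>2)"
    using finite_card_subsets by (simp add: sum.inter_filter[symmetric] conj_assoc)
  finally show ?thesis unfolding prob_kdpp_row_gram by simp
qed

lemma prob_kdpp_superset:
  assumes Wi: "Wi \<in> carrier_mat n n" and inv: "transpose_mat M * M * Wi = 1\<^sub>m n"
    and A: "A \<subseteq> {..<m}"
  shows "measure_pmf.prob (kdpp (row_gram M) n) {S. A \<subseteq> S}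
    = det (principal_submatrix (M * Wi * transpose_mat M) A)"
  unfolding prob_kdpp_row_gram using sum_det_superset[OF M Wi inv A] det by simp

end

subsection \<open>Observability Gramians\<close>

text \<open>A common form for comparison: Gramians and weighted Gram matrices of
  \<open>obs_matrix\<close> both become double sums over time \<open>k\<close> and sensor
  \<open>l\<close>.\<close>

lemma obs_gramian_index:
  assumes A: "A \<in> carrier_mat n n" and C: "C \<in> carrier_mat p n" and ij: "i < n" "j < n"
  shows "obs_gramian A C N $$ (i, j) = (\<Sum>k<N. \<Sum>l<p. (C * A ^\<^sub>m k) $$ (l, i) * (C * A ^\<^sub>m k) $$ (l, j))"
proof -
  have "(transpose_mat (A ^\<^sub>m k) * transpose_mat C * C * A ^\<^sub>m k) $$ (i, j)
      = (\<Sum>l<p. (C * A ^\<^sub>m k) $$ (l, i) * (C * A ^\<^sub>m k) $$ (l, j))" for k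
  proof -
    have Ak: "A ^\<^sub>m k \<in> carrier_mat n n" using A by simp
    then have CAk: "C * A ^\<^sub>m k \<in> carrier_mat p n" using C by simp
    have "transpose_mat (A ^\<^sub>m k) * transpose_mat C * C * A ^\<^sub>m k
      = transpose_mat (C * A ^\<^sub>m k) * (C * A ^\<^sub>m k)"
      unfolding transpose_mult[OF C Ak]
      by (rule assoc_mult_mat[of _ n p _ n _ n]) (use Ak C in auto)
    moreover have "(transpose_mat X * X) $$ (i, j) = (\<Sum>l<p. X $$ (l, i) * X $$ (l, j))"
      if "X \<in> carrier_mat p n" for X :: "real mat"
      using that ij by (simp add: scalar_prod_def atLeast0LessThan)
    ultimately show ?thesis using CAk by simp
  qed
  then show ?thesis using A ij unfolding obs_gramian_def by simp
qed

lemma obs_matrix_weighted_gram_index: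
  assumes A: "A \<in> carrier_mat n n" and C: "C \<in> carrier_mat p n" and ij: "i < n" "j < n"
  shows "(transpose_mat (obs_matrix A C N) * (mat_diag (N * p) z * obs_matrix A C N)) $$ (i, j)
    = (\<Sum>k<N. \<Sum>l<p. z (k * p + l) * (C * A ^\<^sub>m k) $$ (l, i) * (C * A ^\<^sub>m k) $$ (l, j))"
proof -
  let ?f = "\<lambda>r. z r * (C * A ^\<^sub>m (r div p)) $$ (r mod p, i) * (C * A ^\<^sub>m (r div p)) $$ (r mod p, j)"
  have Ob: "obs_matrix A C N \<in> carrier_mat (N * p) n" using A C by (simp add: obs_matrix_def)
  have "(transpose_mat (obs_matrix A C N) * (mat_diag (N * p) z * obs_matrix A C N)) $$ (i, j)
    = (\<Sum>r<N * p. ?f r)"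
    unfolding transpose_weighted_gram_index[OF Ob ij]
    using A C ij by (intro sum.cong) (auto simp: obs_matrix_def)
  \<comment> \<open>The stacked rows are cut into \<open>N\<close> blocks of length
    \<open>p\<close>, one per time step.\<close>
  also have "\<dots> = (\<Sum>k<N. \<Sum>r = k * p..<k * p + p. ?f r)"
    by (rule sum.nat_group[symmetric])
  also have "\<dots> = (\<Sum>k<N. \<Sum>l<p. ?f (k * p + l))"
    using sum.shift_bounds_nat_ivl[of ?f 0 "_ * p" p]
    by (simp add: atLeast0LessThan add.commute)
  also have "\<dots> = (\<Sum>k<N. \<Sum>l<p. z (k * p + l) * (C * A ^\<^sub>m k) $$ (l, i) * (C * A ^\<^sub>m k) $$ (l, j))"
    by (intro sum.cong) auto
  finally show ?thesis .
qed

lemma obs_gramian_eq: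
  assumes A: "A \<in> carrier_mat n n" and C: "C \<in> carrier_mat p n"
  shows "obs_gramian A C N = transpose_mat (obs_matrix A C N) * obs_matrix A C N"
proof -
  have Ob: "obs_matrix A C N \<in> carrier_mat (N * p) n" using A C by (simp add: obs_matrix_def)
  have "obs_gramian A C N = transpose_mat (obs_matrix A C N) * (mat_diag (N * p) (\<lambda>_. 1) * obs_matrix A C N)"
  proof (rule eq_matI, goal_cases)
    case (1 i j)
    then have ij: "i < n" "j < n" using Ob by auto
    show ?case unfolding obs_gramian_index[OF A C ij] obs_matrix_weighted_gram_index[OF A C ij] by simp
  qed (use Ob A in \<open>auto simp: obs_gramian_def\<close>)
  then show ?thesis using Ob by (simp only: mat_diag_one left_mult_one_mat)
qed

text \<open>Removing a sensor amounts to giving weight 0 to all its measurements. This identifies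
  the numerator in \<open>prob_kdpp_subset\<close> with the determinant of the Gramian of
  \<open>Y\<close>.\<close>

lemma obs_gramian_sensors_eq:
  assumes A: "A \<in> carrier_mat n n" and C: "C \<in> carrier_mat p n" and Y: "Y \<subseteq> {..<p}"
  shows "obs_gramian_sensors A C N Y = transpose_mat (obs_matrix A C N) *
    (mat_diag (N * p) (\<lambda>r. if r \<in> sensor_measurements p N Y then 1 else 0) * obs_matrix A C N)"
    (is "_ = transpose_mat _ * (mat_diag _ ?z * _)")
proof -
  have Ob: "obs_matrix A C N \<in> carrier_mat (N * p) n" using A C by (simp add: obs_matrix_def)
  have CY: "row_submatrix C Y \<in> carrier_mat (card Y) n" by (rule row_submatrix_carrier[OF C Y])
  \<comment> \<open>All sensors in \<open>Y\<close> are below \<open>p\<close>, so the remainder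
    modulo \<open>p\<close> recovers the sensor from the measurement; the weight is the same at
    every time.\<close>
  have z: "?z (k * p + l) = (if l \<in> Y then 1 else 0)" if "k < N" "l < p" for k l
  proof -
    have "l \<in> Y" if eq: "k * p + l = k' * p + i" and i: "i \<in> Y" for k' i
    proof -
      have "i < p" using i Y by auto
      then have "l = i" using arg_cong[OF eq, of "\<lambda>x. x mod p"] \<open>l < p\<close> by simp
      then show ?thesis using i by simp
    qed
    then show ?thesis using that unfolding sensor_measurements_def by auto
  qed
  show ?thesis
  proof (rule eq_matI, goal_cases)
    case (1 i j)
    then have ij: "i < n" "j < n" using Ob by auto
    define h where "h k l = (C * A ^\<^sub>m k) $$ (l, i) * (C * A ^\<^sub>m k) $$ (l, j)" for k l
    have "(\<Sum>l<card Y. (row_submatrix C Y * A ^\<^sub>m k) $$ (l, i) * (row_submatrix C Y * A ^\<^sub>m k) $$ (l, j))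
      = (\<Sum>l<p. (if l \<in> Y then 1 else 0) * h k l)" for k
    proof -
      have Ak: "A ^\<^sub>m k \<in> carrier_mat n n" using A by simp
      \<comment> \<open>Selecting rows of \<open>C\<close> commutes with multiplication by the power
        of \<open>A\<close> on the right.\<close>
      have "(row_submatrix C Y * A ^\<^sub>m k) $$ (l, i) = (C * A ^\<^sub>m k) $$ (pick Y l, i)"
        if "l < card Y" "i < n" for l i
        unfolding row_submatrix_mult[OF C Ak Y, symmetric]
        using that by (intro row_submatrix_index[OF mult_carrier_mat[OF C Ak] Y])
      then have "(\<Sum>l<card Y. (row_submatrix C Y * A ^\<^sub>m k) $$ (l, i) * (row_submatrix C Y * A ^\<^sub>m k) $$ (l, j))
        = (\<Sum>l = 0..<card Y. h k (pick Y l))"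
        unfolding h_def atLeast0LessThan using ij by (intro sum.cong) auto
      also have "\<dots> = (\<Sum>l\<in>Y. h k l)"
        using bij_betw_pick finite_subset[OF Y] by (intro sum.reindex_bij_betw) auto
      also have "\<dots> = (\<Sum>l<p. if l \<in> Y then h k l else 0)"
        using Y by (simp add: sum.If_cases Int_absorb1)
      also have "\<dots> = (\<Sum>l<p. (if l \<in> Y then 1 else 0) * h k l)" by (intro sum.cong) auto
      finally show ?thesis .
    qed
    then have "obs_gramian_sensors A C N Y $$ (i, j)
        = (\<Sum>k<N. \<Sum>l<p. (if l \<in> Y then 1 else 0) * h k l)"
      unfolding obs_gramian_sensors_def obs_gramian_index[OF A CY ij] by simp
    also have "\<dots> = (\<Sum>k<N. \<Sum>l<p.
        ?z (k * p + l) * (C * A ^\<^sub>m k) $$ (l, i) * (C * A ^\<^sub>m k) $$ (l, j))"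
      by (intro sum.cong refl) (simp add: z h_def)
    finally show ?case unfolding obs_matrix_weighted_gram_index[OF A C ij] .
  qed (use Ob A in \<open>auto simp: obs_gramian_sensors_def obs_gramian_def\<close>)
qed

theorem theorem3:
  fixes A C Ob Wo L Ko Wo_inv :: "real mat" and n p N :: nat and P :: "nat set pmf"
  assumes A: "A \<in> carrier_mat n n"
    and C: "C \<in> carrier_mat p n"
    and N: "N \<ge> 1"
    and Ob: "Ob = obs_matrix A C N"
    and Wo: "Wo = obs_gramian A C N"
    and rank: "vec_space.rank (N * p) Ob = n"
    and L: "L = row_gram Ob"
    and P: "P = kdpp L n"
    and Wo_inv: "Wo_inv = the (mat_inverse Wo)"
    and Ko: "Ko = Ob * Wo_inv * transpose_mat Ob"
  shows "(Wo = transpose_mat Ob * Ob \<and> pos_def_mat Wo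
      \<and> set_pmf P \<subseteq> {S. S \<subseteq> {..<N * p} \<and> card S = n})
    \<and> (length (eigvals L) = N * p \<and> length (eigvals Wo) = n
      \<and> filter (\<lambda>x. x \<noteq> 0) (eigvals L) = eigvals Wo
      \<and> elem_sym n (eigvals L) = det Wo)
    \<and> (\<forall>S. S \<subseteq> {..<N * p} \<and> card S = n \<longrightarrow>
        pmf P S = det (principal_submatrix L S) / det Wo
        \<and> det (principal_submatrix L S) / det Wo = (det (row_submatrix Ob S))\<^sup>2 / det Wo)
    \<and> (inverts_mat Wo Wo_inv \<and> inverts_mat Wo_inv Wo
      \<and> orthogonal_projection_mat Ko
      \<and> marginal_kernel (N * p) P Ko
      \<and> (\<forall>i < N * p. measure_pmf.prob P {Y'. i \<in> Y'} = Ko $$ (i, i)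
            \<and> Ko $$ (i, i) = row Ob i \<bullet> (Wo_inv *\<^sub>v row Ob i)))
    \<and> (\<forall>Y \<subseteq> {..<p}. measure_pmf.prob P {Y'. Y' \<subseteq> sensor_measurements p N Y}
      = det (obs_gramian_sensors A C N Y) / det Wo)"
proof -
  have O: "Ob \<in> carrier_mat (N * p) n" using A C by (simp add: Ob obs_matrix_def)
  have Wo_eq: "Wo = transpose_mat Ob * Ob" unfolding Wo Ob by (rule obs_gramian_eq[OF A C])
  have pd: "pos_def_mat Wo" unfolding Wo_eq by (rule pos_def_gram[OF O rank])
  have det: "det (transpose_mat Ob * Ob) \<noteq> 0" using pos_def_det_nonzero[OF pd] by (simp add: Wo_eq)
  have W: "Wo \<in> carrier_mat n n" unfolding Wo_eq using O by simp
  note inv = mat_inverse_det_nonzero[OF W, folded Wo_inv, OF pos_def_det_nonzero[OF pd]]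
  have K: "Ko \<in> carrier_mat (N * p) (N * p)" unfolding Ko using O inv(1) by simp
  have marginal: "measure_pmf.prob P {Y'. A' \<subseteq> Y'} = det (principal_submatrix Ko A')"
    if "A' \<subseteq> {..<N * p}" for A'
    unfolding P L Ko using prob_kdpp_superset[OF O det inv(1) _ that] inv(2) by (simp add: Wo_eq)
  have "measure_pmf.prob P {Y'. i \<in> Y'} = Ko $$ (i, i)
    \<and> Ko $$ (i, i) = row Ob i \<bullet> (Wo_inv *\<^sub>v row Ob i)" if i: "i < N * p" for i
  proof
    \<comment> \<open>The inclusion of a single measurement is the marginal of a singleton, whose
      minor is the one entry at \<open>pick {i} 0 = i\<close>.\<close>
    have sub: "{i} \<subseteq> {..<N * p}" using i by simp
    have "principal_submatrix Ko {i} \<in> carrier_mat 1 1"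
      using principal_submatrix_carrier[OF K sub] by simp
    then have "det (principal_submatrix Ko {i}) = principal_submatrix Ko {i} $$ (0, 0)"
      by (simp add: det_single)
    also have "\<dots> = Ko $$ (i, i)"
      using principal_submatrix_index[OF K sub, of 0 0] pick_in_set[of 0 "{i}"] by simp
    finally show "measure_pmf.prob P {Y'. i \<in> Y'} = Ko $$ (i, i)"
      using marginal[OF sub] by simp
    have "Ko = Ob * (Wo_inv * transpose_mat Ob)"
      unfolding Ko using O inv(1) by (simp add: assoc_mult_mat[of _ "N * p" n _ n _ "N * p"])
    then have "Ko $$ (i, i) = row Ob i \<bullet> col (Wo_inv * transpose_mat Ob) i"
      using i O inv(1) by simp
    also have "col (Wo_inv * transpose_mat Ob) i = Wo_inv *\<^sub>v row Ob i"
      using i O inv(1) by (intro eq_vecI) auto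
    finally show "Ko $$ (i, i) = row Ob i \<bullet> (Wo_inv *\<^sub>v row Ob i)" .
  qed
  moreover have "orthogonal_projection_mat Ko" unfolding Ko
    using orthogonal_projection_gram_inverse[OF O inv(1)] inv(2,3) by (simp add: Wo_eq)
  moreover have "inverts_mat Wo Wo_inv" "inverts_mat Wo_inv Wo"
    using inv W unfolding inverts_mat_def by auto
  moreover have "marginal_kernel (N * p) P Ko" unfolding marginal_kernel_def using K marginal by blast
  moreover have "measure_pmf.prob P {Y'. Y' \<subseteq> sensor_measurements p N Y}
      = det (obs_gramian_sensors A C N Y) / det Wo" if "Y \<subseteq> {..<p}" for Y
    unfolding obs_gramian_sensors_eq[OF A C that] P L Wo_eq
    using prob_kdpp_subset[OF O det] by (simp add: Ob)
  moreover have "pmf P S = det (principal_submatrix L S) / det Wo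
      \<and> det (principal_submatrix L S) / det Wo = (det (row_submatrix Ob S))\<^sup>2 / det Wo"
    if "S \<subseteq> {..<N * p}" "card S = n" for S
    using that unfolding P L Wo_eq by (simp add: pmf_kdpp_row_gram[OF O det] det_principal_row_gram[OF O])
  moreover have "set_pmf P \<subseteq> {S. S \<subseteq> {..<N * p} \<and> card S = n}"
    unfolding P L by (rule set_pmf_kdpp_row_gram[OF O det])
  moreover have "length (eigvals L) = N * p" "length (eigvals Wo) = n"
      "filter (\<lambda>x. x \<noteq> 0) (eigvals L) = eigvals Wo" "elem_sym n (eigvals L) = det Wo"
    unfolding L Wo_eq
    by (rule length_eigvals_gram[OF O det] filter_eigvals_row_gram[OF O det] elem_sym_eigvals_row_gram[OF O det])+
  ultimately show ?thesis using Wo_eq pd by blast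
qed

end
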